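(* Let $\rho\approx 0.75488$ be the (unique) real root of $\rho^2+\rho^3=1$. Then $\mu_2\leqslant 1+\rho$, where $$\mu_2 = \inf_{\boldsymbol{a}}\ \limsup_{n\to\infty}\ \mu^2_n(\boldsymbol{a}),$$ the infimum being over all infinite sequences $\boldsymbol{a}=(a_i)_{i=1}^\infty$ of (pairwise distinct) points on a circle, and $\mu^2_n(\boldsymbol{a})$ being the ratio of the maximum total size of two consecutive slices to the minimum total size of two consecutive slices after the first $n$ cuts $a_1,\dots,a_n$.
   Context: An infinite sequence $\boldsymbol{a}=(a_i)_{i=1}^\infty$ of points on a circle is viewed as an infinite sequence of radial cuts of a circular cake. For each $n$, the first $n$ points $a_1,\dots,a_n$ split the circle into $n$ arcs, called slices, which are cyclically ordered around the circle; the size of a slice is the length of its arc (the circle may be normalised to have total length $1$). For $n\geqslant 2$, two consecutive slices are two slices that are adjacent in the cyclic order, and their (total) size is the sum of the sizes of the two slices. $\mu^2_n(\boldsymbol{a})$ denotes the ratio of the maximum size of two consecutive slices to the minimum size of two consecutive slices, over all choices of two consecutive slices among the $n$ slices determined by $a_1,\dots,a_n$. *)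

theory Defs
  imports Complex_Main "HOL-Library.Extended_Real" "HOL-Library.Liminf_Limsup"
begin

text \<open>The circle has length 1 and is represented by \<open>{0..<1}\<close>, a point being its
  arc length from a fixed base point. Sequences are indexed from 0, so the first \<open>n\<close> cuts
  are \<open>a 0, \<dots>, a (n - 1)\<close>.\<close>

definition cut_sequence :: "(nat \<Rightarrow> real) \<Rightarrow> bool" where
  "cut_sequence a \<longleftrightarrow> range a \<subseteq> {0..<1} \<and> inj a"

definition cuts :: "(nat \<Rightarrow> real) \<Rightarrow> nat \<Rightarrow> real list" where
  "cuts a n = sorted_list_of_set (a ` {..<n})"

text \<open>For \<open>i < n\<close>, the size of the slice from the \<open>i\<close>-th cut, in sorted order, to its
  cyclic successor. The slice with \<open>i = n - 1\<close> is the one passing through the base point.\<close>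

definition slice_size :: "(nat \<Rightarrow> real) \<Rightarrow> nat \<Rightarrow> nat \<Rightarrow> real" where
  "slice_size a n i =
     (if Suc i < n then cuts a n ! Suc i - cuts a n ! i
      else 1 + cuts a n ! 0 - cuts a n ! i)"

definition pair_sizes :: "(nat \<Rightarrow> real) \<Rightarrow> nat \<Rightarrow> real set" where
  "pair_sizes a n = (\<lambda>i. slice_size a n i + slice_size a n (Suc i mod n)) ` {..<n}"

text \<open>Only meaningful for \<open>n \<ge> 2\<close>; the values at 0 and 1 do not affect the limit superior.\<close>

definition pair_ratio :: "(nat \<Rightarrow> real) \<Rightarrow> nat \<Rightarrow> real" where
  "pair_ratio a n = Max (pair_sizes a n) / Min (pair_sizes a n)"

text \<open>Extended reals, since the limit superior may be infinite for some sequences.\<close>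

definition mu2 :: ereal where
  "mu2 = (INF a \<in> {a. cut_sequence a}. limsup (\<lambda>n. ereal (pair_ratio a n)))"

end

theory Submission
  imports Defs
begin

text \<open>
  The bound is attained by an explicit way of cutting in which every slice has size
  \<open>\<rho> ^ k\<close> for some \<open>k\<close>. Since \<open>\<rho>\<^sup>2 + \<rho> ^ 3 = 1\<close>, a slice of size \<open>\<rho> ^ m\<close> can be cut
  into slices of sizes \<open>\<rho> ^ (m + 2)\<close> and \<open>\<rho> ^ (m + 3)\<close>. If each cut is made in a largest
  slice, of size \<open>\<rho> ^ m\<close> say, then the sizes present at any moment are among
  \<open>\<rho> ^ m, \<dots>, \<rho> ^ (m + 3)\<close>. If moreover two neighbouring slices never have the same size,
  the sum of two neighbours is at most \<open>\<rho> ^ m + \<rho> ^ (m + 1)\<close> and at least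
  \<open>\<rho> ^ (m + 2) + \<rho> ^ (m + 3) = \<rho> ^ m\<close>, and the ratio of such sums is at most \<open>1 + \<rho>\<close>.

  It remains to arrange the two halves of each cut slice so that equal neighbours never
  occur. Write A, B, C, D for the exponents \<open>m, \<dots>, m + 3\<close>, going around the circle. The
  invariant is that the neighbours, in order, form one of the pairs
  AB, BA, BC, CA, CB, CD, DB, DC. In particular each A is followed by B and preceded by
  B or C. Replacing BAB by BCDB and CAB by CDCB creates only pairs from this list.
  When the last A has disappeared, the pairs BC, CB, CD, DB, DC are left, and renaming
  B, C, D to A, B, C (that is, increasing \<open>m\<close>) turns them into AB, BA, BC, CA, CB, which are
  in the list. After two cuts the slices are \<open>\<rho>\<^sup>2, \<rho> ^ 3\<close>, which satisfy the
  invariant with \<open>m = 2\<close>, and the process never stops.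

  The invariant is \<open>neighbour_ok\<close>, its preservation is \<open>balanced_split\<close>, and
  \<open>cut_sequence_of_refinements\<close> turns a sequence of successively refined lists of slice sizes
  into a sequence of cuts.
\<close>

section \<open>Cuts from lists of slice sizes\<close>

fun marks :: "real \<Rightarrow> real list \<Rightarrow> real list" where
  "marks s [] = []"
| "marks s (x # xs) = s # marks (s + x) xs"

lemma length_marks [simp]: "length (marks s xs) = length xs"
  by (induction xs arbitrary: s) auto

lemma marks_append: "marks s (xs @ ys) = marks s xs @ marks (s + sum_list xs) ys"
  by (induction xs arbitrary: s) (auto simp: add.assoc)

lemma nth_marks: "i < length xs \<Longrightarrow> marks s xs ! i = s + sum_list (take i xs)"
proof (induction xs arbitrary: s i)
  case (Cons x xs)
  then show ?case by (cases i) auto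
qed simp

lemma marks_bounds:
  assumes "\<forall>x\<in>set xs. x > 0" "t \<in> set (marks s xs)"
  shows "s \<le> t" "t < s + sum_list xs"
proof -
  have "s \<le> t \<and> t < s + sum_list xs"
    using assms
  proof (induction xs arbitrary: s)
    case (Cons x xs)
    show ?case
    proof (cases "t = s")
      case True
      have "sum_list xs \<ge> 0"
        using Cons.prems(1) by (intro sum_list_nonneg) (auto intro: less_imp_le)
      then show ?thesis using True Cons.prems(1) by auto
    next
      case False
      then show ?thesis using Cons.IH[of "s + x"] Cons.prems by auto
    qed
  qed simp
  then show "s \<le> t" "t < s + sum_list xs" by auto
qed

lemma strict_sorted_marks:
  assumes "\<forall>x\<in>set xs. x > 0"
  shows "sorted_wrt (<) (marks s xs)"
  using assms
proof (induction xs arbitrary: s)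
  case (Cons x xs)
  then show ?case using marks_bounds(1)[of xs _ "s + x"] by force
qed simp

lemma slice_size_eq_nth:
  assumes pos: "\<forall>x\<in>set xs. x > 0" and total: "sum_list xs = 1"
    and image: "a ` {..<length xs} = set (marks 0 xs)" and i: "i < length xs"
  shows "slice_size a (length xs) i = xs ! i"
proof -
  have "sorted (marks 0 xs)" "distinct (marks 0 xs)"
    using strict_sorted_marks[OF pos] by (auto simp: strict_sorted_iff)
  then have cuts: "cuts a (length xs) = marks 0 xs"
    unfolding cuts_def image by (simp add: sorted_list_of_set.idem_if_sorted_distinct)
  have take: "sum_list (take (Suc i) xs) = sum_list (take i xs) + xs ! i"
    using i by (simp add: take_Suc_conv_app_nth)
  show ?thesis
  proof (cases "Suc i < length xs")
    case True
    then show ?thesis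
      using take by (simp add: slice_size_def cuts nth_marks)
  next
    case False
    then have "take (Suc i) xs = xs" using i by simp
    then have "sum_list (take i xs) + xs ! i = 1" using take total by simp
    moreover have "xs \<noteq> []" using i by auto
    ultimately show ?thesis
      using False i by (simp add: slice_size_def cuts nth_marks)
  qed
qed

definition refines :: "real list \<Rightarrow> real list \<Rightarrow> bool" where
  "refines xs ys \<longleftrightarrow> (\<exists>us p q vs. xs = us @ (p + q) # vs \<and> ys = us @ p # q # vs)"

lemma refines_length: "refines xs ys \<Longrightarrow> length ys = Suc (length xs)"
  by (auto simp: refines_def)

lemma refines_sum_list: "refines xs ys \<Longrightarrow> sum_list ys = sum_list xs"
  by (auto simp: refines_def)

lemma refines_new_mark:
  assumes "refines xs ys" and pos: "\<forall>x\<in>set ys. x > 0"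
  shows "\<exists>t. t \<notin> set (marks s xs) \<and> set (marks s ys) = insert t (set (marks s xs))"
proof -
  obtain us p q vs where xs: "xs = us @ (p + q) # vs" and ys: "ys = us @ p # q # vs"
    using assms(1) by (auto simp: refines_def)
  let ?t = "s + sum_list us + p"
  have "distinct (marks s ys)"
    using strict_sorted_marks[OF pos] by (simp add: strict_sorted_iff)
  then have "?t \<notin> set (marks s xs)"
    by (auto simp: xs ys marks_append add.assoc)
  moreover have "set (marks s ys) = insert ?t (set (marks s xs))"
    by (auto simp: xs ys marks_append add.assoc)
  ultimately show ?thesis by blast
qed

text \<open>A refinement adds a single new mark and keeps the old ones, so the marks can be listed in
  the order in which they appear. Dividing the circle by cuts thus reduces to dividing
  lists of sizes.\<close>

lemma cut_sequence_of_refinements: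
  assumes start: "X 0 = [1]" and step: "\<And>n. refines (X n) (X (Suc n))"
    and pos: "\<And>n. \<forall>x\<in>set (X n). x > 0"
  shows "\<exists>a. cut_sequence a \<and> (\<forall>n. \<forall>i\<le>n. slice_size a (Suc n) i = X n ! i)"
proof -
  have len: "length (X n) = Suc n" for n
    by (induction n) (auto simp: start refines_length[OF step])
  have total: "sum_list (X n) = 1" for n
    by (induction n) (auto simp: start refines_sum_list[OF step])
  obtain t where t_new: "\<And>n. t n \<notin> set (marks 0 (X n))"
    and t_insert: "\<And>n. set (marks 0 (X (Suc n))) = insert (t n) (set (marks 0 (X n)))"
    using refines_new_mark[OF step pos] by metis
  define a where "a = case_nat 0 t"
  have image: "a ` {..<Suc n} = set (marks 0 (X n))" for n
    by (induction n) (simp_all add: a_def start t_insert lessThan_Suc)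
  have "inj a"
  proof (rule linorder_injI)
    fix i j :: nat
    assume "i < j"
    then obtain k where j: "j = Suc k" and "i < Suc k" by (cases j) auto
    then have "a i \<in> set (marks 0 (X k))" using image[of k] by blast
    moreover have "a j = t k" by (simp add: a_def j)
    ultimately show "a i \<noteq> a j" using t_new[of k] by metis
  qed
  moreover have "a i \<in> {0..<1}" for i
  proof -
    have "a i \<in> set (marks 0 (X i))" using image[of i] by blast
    then show ?thesis using marks_bounds[OF pos, of "a i" 0 i] total[of i] by simp
  qed
  ultimately have "cut_sequence a" by (auto simp: cut_sequence_def)
  moreover have "slice_size a (Suc n) i = X n ! i" if "i \<le> n" for n i
    using slice_size_eq_nth[OF pos total, of a n i] image[of n] that by (simp add: len)
  ultimately show ?thesis by blast
qed

section \<open>Cyclic words\<close>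

definition cyclically :: "('a \<Rightarrow> 'a \<Rightarrow> bool) \<Rightarrow> 'a list \<Rightarrow> bool" where
  "cyclically P ws \<longleftrightarrow> ws \<noteq> [] \<and> successively P (ws @ [hd ws])"

lemma cyclically_Cons:
  "cyclically P (w # ws) \<longleftrightarrow>
     (if ws = [] then P w w else P w (hd ws) \<and> successively P ws \<and> P (last ws) w)"
  by (auto simp: cyclically_def successively_append_iff successively_Cons hd_append)

lemma cyclically_rotate: "cyclically P (us @ vs) \<longleftrightarrow> cyclically P (vs @ us)"
  by (cases "us = []"; cases "vs = []")
     (auto simp: cyclically_def successively_append_iff hd_append)

lemma cyclically_nth:
  assumes "cyclically P ws" "i < length ws"
  shows "P (ws ! i) (ws ! (Suc i mod length ws))"
proof -
  have "P ((ws @ [hd ws]) ! i) ((ws @ [hd ws]) ! Suc i)"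
    using assms by (auto simp: cyclically_def successively_conv_nth)
  moreover have "(ws @ [hd ws]) ! Suc i = ws ! (Suc i mod length ws)"
    using assms by (cases "Suc i = length ws") (auto simp: cyclically_def nth_append hd_conv_nth)
  ultimately show ?thesis using assms(2) by (simp add: nth_append)
qed

lemma cyclically_nthI:
  assumes "ws \<noteq> []" "\<And>i. i < length ws \<Longrightarrow> P (ws ! i) (ws ! (Suc i mod length ws))"
  shows "cyclically P ws"
  unfolding cyclically_def successively_conv_nth
proof (intro conjI allI impI assms(1))
  fix i
  assume "Suc i < length (ws @ [hd ws])"
  then have i: "i < length ws" by simp
  have "(ws @ [hd ws]) ! Suc i = ws ! (Suc i mod length ws)"
    using assms(1) i by (cases "Suc i = length ws") (auto simp: nth_append hd_conv_nth)
  then show "P ((ws @ [hd ws]) ! i) ((ws @ [hd ws]) ! Suc i)"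
    using assms(2)[OF i] i by (simp add: nth_append)
qed

lemma cyclically_mono:
  assumes "cyclically P ws"
    and "\<And>x y. x \<in> set ws \<Longrightarrow> y \<in> set ws \<Longrightarrow> P x y \<Longrightarrow> Q x y"
  shows "cyclically Q ws"
proof (rule cyclically_nthI)
  show "ws \<noteq> []" using assms(1) by (simp add: cyclically_def)
  fix i
  assume i: "i < length ws"
  then have "Suc i mod length ws < length ws" by (intro mod_less_divisor) linarith
  then show "Q (ws ! i) (ws ! (Suc i mod length ws))"
    using i cyclically_nth[OF assms(1) i] by (intro assms(2)) auto
qed

section \<open>The balanced arrangement of slices\<close>

text \<open>The pairs AB, BA, BC, CA, CB, CD, DB, DC, where A is the exponent \<open>m\<close> of a largest
  slice.\<close>

definition neighbour_ok :: "nat \<Rightarrow> nat \<Rightarrow> nat \<Rightarrow> bool" where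
  "neighbour_ok m x y \<longleftrightarrow> (x, y) \<in>
     {(m, m + 1), (m + 1, m), (m + 1, m + 2), (m + 2, m), (m + 2, m + 1), (m + 2, m + 3),
      (m + 3, m + 1), (m + 3, m + 2)}"

lemma neighbour_ok_cases:
  assumes "neighbour_ok m x y"
  obtains "x = m" "y = m + 1" | "x = m + 1" "y = m" | "x = m + 1" "y = m + 2"
    | "x = m + 2" "y = m" | "x = m + 2" "y = m + 1" | "x = m + 2" "y = m + 3"
    | "x = m + 3" "y = m + 1" | "x = m + 3" "y = m + 2"
  using assms unfolding neighbour_ok_def by (simp only: insert_iff empty_iff prod.inject) blast

lemma neighbour_ok_intros:
  "neighbour_ok m m (m + 1)" "neighbour_ok m (m + 1) m" "neighbour_ok m (m + 1) (m + 2)"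
  "neighbour_ok m (m + 2) m" "neighbour_ok m (m + 2) (m + 1)" "neighbour_ok m (m + 2) (m + 3)"
  "neighbour_ok m (m + 3) (m + 1)" "neighbour_ok m (m + 3) (m + 2)"
  by (simp_all add: neighbour_ok_def)

lemma neighbour_ok_Suc:
  assumes "neighbour_ok m x y" "x \<noteq> m" "y \<noteq> m"
  shows "neighbour_ok (Suc m) x y"
  using assms(1)
  by (cases rule: neighbour_ok_cases)
     (use assms(2,3) neighbour_ok_intros[of "Suc m"] in \<open>simp_all add: numeral_eq_Suc\<close>)

definition balanced :: "nat list \<Rightarrow> bool" where
  "balanced ks \<longleftrightarrow> (\<exists>m. cyclically (neighbour_ok m) ks)"

text \<open>Words such as CDCD lack both A and B, so the level \<open>m\<close> may have to rise more than once
  before a slice of size \<open>\<rho> ^ m\<close> exists; no exponent is below the level, so this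
  ends.\<close>

lemma balanced_obtains_level:
  assumes "balanced ks"
  obtains m where "m \<in> set ks" "cyclically (neighbour_ok m) ks"
proof -
  have "\<exists>m\<in>set ks. cyclically (neighbour_ok m) ks" if "cyclically (neighbour_ok m) ks" for m
    using that
  proof (induction "hd ks - m" arbitrary: m rule: less_induct)
    case less
    show ?case
    proof (cases "m \<in> set ks")
      case False
      have ne: "ks \<noteq> []" using less.prems by (simp add: cyclically_def)
      then have "hd ks \<ge> m"
        using cyclically_nth[OF less.prems, of 0] by (auto elim: neighbour_ok_cases simp: hd_conv_nth)
      moreover have "hd ks \<noteq> m" using False ne by auto
      moreover have "cyclically (neighbour_ok (Suc m)) ks"
        using less.prems
        by (rule cyclically_mono) (metis False neighbour_ok_Suc)
      ultimately show ?thesis using less.hyps[of "Suc m"] by simp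
    qed (use less.prems in blast)
  qed
  then show ?thesis using assms that by (auto simp: balanced_def)
qed

text \<open>The order of the two new slices is dictated by the left neighbour of the slice that is
  cut: after B the new slices are CD, after C they are DC. The right neighbour is always B,
  next to which both C and D are admissible on the left.\<close>

lemma balanced_split:
  assumes "balanced ks"
  shows "\<exists>us m p q vs. ks = us @ m # vs \<and> {p, q} = {m + 2, m + 3} \<and> balanced (us @ p # q # vs)"
proof -
  obtain m where m: "m \<in> set ks" and cyc: "cyclically (neighbour_ok m) ks"
    using balanced_obtains_level[OF assms] .
  obtain us vs where ks: "ks = us @ m # vs"
    using split_list[OF m] by blast
  \<comment> \<open>Rotating the word puts the slice to be cut first, so that the base point of the circle
    needs no separate treatment.\<close>
  define ws where "ws = vs @ us"
  have "cyclically (neighbour_ok m) (m # ws)"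
    using cyc cyclically_rotate[of _ us "m # vs"] by (simp add: ks ws_def)
  moreover have "\<not> neighbour_ok m m m" by (auto simp: neighbour_ok_def)
  ultimately have ws: "ws \<noteq> []" and right: "neighbour_ok m m (hd ws)"
    and inner: "successively (neighbour_ok m) ws" and left: "neighbour_ok m (last ws) m"
    by (auto simp: cyclically_Cons split: if_splits)
  define p q where "p = (if last ws = m + 1 then m + 2 else m + 3)"
    and "q = (if last ws = m + 1 then m + 3 else m + 2)"
  have "hd ws = m + 1"
    using right by (cases rule: neighbour_ok_cases) auto
  moreover have "last ws = m + 1 \<or> last ws = m + 2"
    using left by (cases rule: neighbour_ok_cases) auto
  ultimately have "neighbour_ok m p q" "neighbour_ok m q (hd ws)" "neighbour_ok m (last ws) p"
    using neighbour_ok_intros[of m] by (auto simp: p_def q_def)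
  then have "cyclically (neighbour_ok m) (p # q # ws)"
    using ws inner by (cases ws) (auto simp: cyclically_Cons)
  then have "cyclically (neighbour_ok m) (us @ p # q # vs)"
    using cyclically_rotate[of _ us "p # q # vs"] by (simp add: ws_def)
  moreover have "{p, q} = {m + 2, m + 3}" by (auto simp: p_def q_def)
  ultimately show ?thesis using ks unfolding balanced_def by blast
qed

text \<open>The extremes are CD, whose sum is exactly \<open>r ^ m\<close> by the equation for \<open>r\<close>, and AB.\<close>

lemma neighbour_ok_sum_bounds:
  fixes r :: real
  assumes r: "r\<^sup>2 + r ^ 3 = 1" "0 < r" "r < 1" and ok: "neighbour_ok m x y"
  shows "r ^ m \<le> r ^ x + r ^ y" "r ^ x + r ^ y \<le> r ^ m * (1 + r)"
proof -
  obtain i j where xy: "x = m + i" "y = m + j"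
    and ij: "(i, j) \<in> {(0, 1), (1, 0), (1, 2), (2, 0), (2, 1), (2, 3), (3, 1), (3, 2)}"
  proof -
    have "\<exists>i j. x = m + i \<and> y = m + j \<and>
        (i, j) \<in> {(0, 1), (1, 0), (1, 2), (2, 0), (2, 1), (2, 3), (3, 1), (3, 2)}"
      using ok by (cases rule: neighbour_ok_cases) force+
    then show ?thesis using that by blast
  qed
  have sq: "r\<^sup>2 \<le> r" "r ^ 3 \<le> r\<^sup>2" "0 < r ^ 3"
    using r(2,3) by (auto simp: power2_eq_square power3_eq_cube mult_le_cancel_left1
        mult_le_cancel_right1)
  have "1 \<le> r ^ i + r ^ j \<and> r ^ i + r ^ j \<le> 1 + r"
    using ij r sq by auto
  then have "r ^ m * 1 \<le> r ^ m * (r ^ i + r ^ j)" "r ^ m * (r ^ i + r ^ j) \<le> r ^ m * (1 + r)"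
    using r(2) by (auto intro!: mult_left_mono simp del: mult_1_right)
  then show "r ^ m \<le> r ^ x + r ^ y" "r ^ x + r ^ y \<le> r ^ m * (1 + r)"
    by (simp_all add: xy power_add distrib_left)
qed

section \<open>The bound\<close>

lemma balanced_pair_ratio_le:
  fixes r :: real
  assumes r: "r\<^sup>2 + r ^ 3 = 1" "0 < r" "r < 1" and bal: "balanced ks"
    and size: "\<And>i. i < length ks \<Longrightarrow> slice_size a (length ks) i = r ^ (ks ! i)"
  shows "pair_ratio a (length ks) \<le> 1 + r"
proof -
  obtain m where cyc: "cyclically (neighbour_ok m) ks"
    using bal by (auto simp: balanced_def)
  let ?S = "pair_sizes a (length ks)"
  have ne: "ks \<noteq> []" using cyc by (simp add: cyclically_def)
  have bounds: "r ^ m \<le> s \<and> s \<le> r ^ m * (1 + r)" if mem: "s \<in> ?S" for s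
  proof -
    obtain i where i: "i < length ks"
      and s: "s = slice_size a (length ks) i + slice_size a (length ks) (Suc i mod length ks)"
      using mem by (auto simp: pair_sizes_def)
    have "Suc i mod length ks < length ks" using ne by simp
    then have "s = r ^ (ks ! i) + r ^ (ks ! (Suc i mod length ks))"
      using i s size by simp
    then show ?thesis
      using neighbour_ok_sum_bounds[OF r cyclically_nth[OF cyc i]] by simp
  qed
  have fin: "finite ?S" "?S \<noteq> {}" using ne by (auto simp: pair_sizes_def)
  have min: "r ^ m \<le> Min ?S" and max: "Max ?S \<le> r ^ m * (1 + r)"
    using fin bounds by auto
  have "Max ?S \<le> Min ?S * (1 + r)"
    using max by (rule order_trans) (use min r(2) in \<open>simp add: mult_right_mono\<close>)
  moreover have "Min ?S > 0" using min zero_less_power[OF r(2), of m] by linarith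
  ultimately show ?thesis by (simp add: pair_ratio_def divide_le_eq mult.commute)
qed

lemma mu2_le:
  fixes r :: real
  assumes r: "r\<^sup>2 + r ^ 3 = 1" "0 < r" "r < 1"
  shows "mu2 \<le> ereal (1 + r)"
proof -
  let ?size = "map (\<lambda>k. r ^ k)"
  have cut: "r ^ m = r ^ p + r ^ q" if "{p, q} = {m + 2, m + 3}" for m p q
  proof -
    have "r ^ m = r ^ (m + 2) + r ^ (m + 3)"
      using r(1) by (simp only: power_add flip: distrib_left)
    then show ?thesis using that by (auto simp: doubleton_eq_iff)
  qed
  have refine: "refines (?size (us @ m # vs)) (?size (us @ p # q # vs))"
    if "{p, q} = {m + 2, m + 3}" for us m p q vs
    using cut[OF that] by (auto simp: refines_def)
  \<comment> \<open>After one cut the only slice is its own neighbour, so balance can hold only from the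
    second cut on.\<close>
  have "\<exists>K. \<forall>n. (if n = 0 then K n = [0] else balanced (K n)) \<and>
      refines (?size (K n)) (?size (K (Suc n)))"
  proof (rule dependent_nat_choice)
    fix ks :: "nat list" and n :: nat
    assume ks: "if n = 0 then ks = [0] else balanced ks"
    show "\<exists>ks'. (if Suc n = 0 then ks' = [0] else balanced ks') \<and>
        refines (?size ks) (?size ks')"
    proof (cases "n = 0")
      case True
      have "cyclically (neighbour_ok 2) [2, 3]"
        by (simp add: cyclically_Cons neighbour_ok_def)
      then have "balanced [2, 3]" unfolding balanced_def by blast
      moreover have "refines (?size [0]) (?size [2, 3])"
        using refine[where us = "[]" and vs = "[]" and m = 0 and p = 2 and q = 3]
        by (simp add: eval_nat_numeral)
      ultimately show ?thesis using ks True by auto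
    next
      case False
      then have "balanced ks" using ks by simp
      then show ?thesis using balanced_split refine by (metis nat.distinct(1))
    qed
  qed (rule exI[of _ "[0]"], simp)
  then obtain K where K0: "K 0 = [0]" and bal: "\<And>n. balanced (K (Suc n))"
    and step: "\<And>n. refines (?size (K n)) (?size (K (Suc n)))"
    by (metis nat.distinct(1))
  have len: "length (K n) = Suc n" for n
    by (induction n) (use K0 refines_length[OF step] in auto)
  obtain a where a: "cut_sequence a"
    and size: "\<And>n i. i \<le> n \<Longrightarrow> slice_size a (Suc n) i = ?size (K n) ! i"
    using cut_sequence_of_refinements[of "\<lambda>n. ?size (K n)"] K0 step r(2) by auto
  have "pair_ratio a n \<le> 1 + r" if n: "n \<ge> 2" for n
  proof -
    obtain k where "n = Suc (Suc k)" using n by (metis Suc_le_D numeral_2_eq_2 Suc_le_mono)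
    then show ?thesis
      using balanced_pair_ratio_le[OF r bal, of k a] size[of _ "Suc k"] by (simp add: len)
  qed
  then have "eventually (\<lambda>n. ereal (pair_ratio a n) \<le> ereal (1 + r)) sequentially"
    unfolding eventually_sequentially by (auto intro!: exI[of _ 2])
  then have "limsup (\<lambda>n. ereal (pair_ratio a n)) \<le> ereal (1 + r)"
    by (rule Limsup_bounded)
  then show ?thesis
    unfolding mu2_def using a by (intro INF_lower2[of a]) auto
qed

lemma root_in_unit_interval:
  fixes r :: real
  assumes "r\<^sup>2 + r ^ 3 = 1"
  shows "0 < r" "r < 1"
proof -
  have eq: "r\<^sup>2 * (1 + r) = 1" using assms by (simp add: power2_eq_square power3_eq_cube algebra_simps)
  show "0 < r"
  proof (rule ccontr)
    assume "\<not> 0 < r"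
    moreover have "0 < r\<^sup>2 * (1 + r)" using eq by simp
    then have "1 + r > 0" by (simp add: zero_less_mult_iff)
    ultimately have "r\<^sup>2 \<le> 1" "r \<le> 0" by (auto simp: abs_square_le_1)
    moreover have "r \<noteq> 0" using eq by auto
    ultimately have "r\<^sup>2 * (1 + r) < 1 * 1"
      using \<open>1 + r > 0\<close> by (intro mult_le_less_imp_less) auto
    then show False using eq by simp
  qed
  show "r < 1"
  proof (rule ccontr)
    assume "\<not> r < 1"
    then have "r\<^sup>2 \<ge> 1" "r ^ 3 \<ge> 1" by auto
    then show False using assms by simp
  qed
qed

lemma ex1_root: "\<exists>!r::real. r\<^sup>2 + r ^ 3 = 1"
proof -
  have "\<exists>r::real. 0 \<le> r \<and> r \<le> 1 \<and> r\<^sup>2 + r ^ 3 = 1"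
    by (rule IVT') (auto intro!: continuous_intros)
  moreover have "\<not> r < s" if "r\<^sup>2 + r ^ 3 = 1" "s\<^sup>2 + s ^ 3 = 1" for r s :: real
  proof
    assume "r < s"
    then have "r\<^sup>2 < s\<^sup>2" "r ^ 3 < s ^ 3"
      using root_in_unit_interval(1)[OF that(1)] by (auto intro!: power_strict_mono)
    then show False using that by simp
  qed
  ultimately show ?thesis by (metis linorder_neqE)
qed

theorem theorem1:
  "(\<exists>!\<rho>::real. \<rho>\<^sup>2 + \<rho> ^ 3 = 1) \<and>
   (\<forall>\<rho>::real. \<rho>\<^sup>2 + \<rho> ^ 3 = 1 \<longrightarrow> mu2 \<le> ereal (1 + \<rho>))"
  using ex1_root mu2_le root_in_unit_interval by blast

end
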